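(* Let $Y$ be a Banach space, let $A:\ell^1(\mathbb{N})\to Y$ be an injective bounded linear operator, and let $(\gamma_n)_{n\in\mathbb{N}}$ be a sequence of positive real numbers. For $n\in\mathbb{N}$ put $\mathcal{M}_n=\{M\subseteq\mathbb{N}:|M|\leq n\}$. The following are equivalent: (1) for each $n\in\mathbb{N}$ and each $\xi\in\bigcup_{M\in\mathcal{M}_n}\mathbf{1}_M$ there is some $\eta=\eta(n,\xi)\in Y^\ast$ such that $\|\eta\|_{Y^\ast}\leq\gamma_n$ and $P_{\supp\xi}A^\ast\eta=\xi$; (2) for each $n\in\mathbb{N}$, $$\|Ax\|_Y\geq\frac{1}{\gamma_n}\|x\|_{\ell^1(\mathbb{N})}\quad\text{for all }x\in\ell^1(\mathbb{N})\text{ with }|\supp x|\leq n.$$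
   Context: Sequences are real and indexed by $\mathbb{N}=\{1,2,\ldots\}$. $A^\ast:Y^\ast\to\ell^\infty(\mathbb{N})$ is the adjoint of $A$, where $\ell^\infty(\mathbb{N})$ is identified with the dual of $\ell^1(\mathbb{N})$. For a sequence $x$, $\supp x=\{k\in\mathbb{N}:x_k\neq0\}$, and $|\cdot|$ applied to a set is its cardinality. For $M\subseteq\mathbb{N}$, $P_M:\ell^\infty(\mathbb{N})\to\ell^\infty(\mathbb{N})$ is given by $[P_M\xi]_k=\xi_k$ if $k\in M$ and $[P_M\xi]_k=0$ otherwise, and $$\mathbf{1}_M:=\{\xi\in\ell^\infty(\mathbb{N}):\supp\xi\subseteq M\text{ and }\xi_k\in\{-1,0,1\}\text{ for all }k\in\mathbb{N}\}.$$ *)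

theory Defs
  imports "HOL-Analysis.Analysis"
begin

text \<open>
  Sequences are functions on \<^typ>\<open>nat\<close>, so position \<open>k\<close> of a sequence indexed from 1 is position
  \<open>k - 1\<close> here.
\<close>

section \<open>The space of absolutely summable sequences\<close>

typedef l1 = "{x :: nat \<Rightarrow> real. summable (\<lambda>k. \<bar>x k\<bar>)}"
  morphisms l1_nth Abs_l1
  by (rule exI[of _ "\<lambda>_. 0"]) simp

setup_lifting type_definition_l1

lemma summable_abs_l1 [simp]: "summable (\<lambda>k. \<bar>l1_nth x k\<bar>)"
  using l1_nth[of x] by simp

lemma l1_eqI: "(\<And>k. l1_nth x k = l1_nth y k) \<Longrightarrow> x = y"
  by transfer auto

lemma summable_abs_bound:
  fixes x y z :: "nat \<Rightarrow> real"
  assumes "summable (\<lambda>k. \<bar>x k\<bar>)" "summable (\<lambda>k. \<bar>y k\<bar>)"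
    and "\<And>k. \<bar>z k\<bar> \<le> \<bar>x k\<bar> + \<bar>y k\<bar>"
  shows "summable (\<lambda>k. \<bar>z k\<bar>)"
  by (rule summable_comparison_test'[OF summable_add[OF assms(1,2)], where N = 0])
    (use assms(3) in auto)

instantiation l1 :: real_vector
begin

lift_definition zero_l1 :: l1 is "\<lambda>_. 0" by simp

lift_definition plus_l1 :: "l1 \<Rightarrow> l1 \<Rightarrow> l1" is "\<lambda>x y k. x k + y k"
  by (auto elim: summable_abs_bound)

lift_definition uminus_l1 :: "l1 \<Rightarrow> l1" is "\<lambda>x k. - x k" by simp

lift_definition minus_l1 :: "l1 \<Rightarrow> l1 \<Rightarrow> l1" is "\<lambda>x y k. x k - y k"
  by (auto elim: summable_abs_bound)

lift_definition scaleR_l1 :: "real \<Rightarrow> l1 \<Rightarrow> l1" is "\<lambda>c x k. c * x k"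
  by (simp add: abs_mult summable_mult)

instance
proof
  fix x y z :: l1 and a b :: real
  show "x + y + z = x + (y + z)" "x + y = y + x" "0 + x = x" "- x + x = 0" "x - y = x + - y"
    by (transfer, simp add: algebra_simps)+
  show "a *\<^sub>R (x + y) = a *\<^sub>R x + a *\<^sub>R y" "(a + b) *\<^sub>R x = a *\<^sub>R x + b *\<^sub>R x"
    "a *\<^sub>R b *\<^sub>R x = (a * b) *\<^sub>R x" "1 *\<^sub>R x = x"
    by (transfer, simp add: algebra_simps)+
qed

end

instantiation l1 :: real_normed_vector
begin

lift_definition norm_l1 :: "l1 \<Rightarrow> real" is "\<lambda>x. \<Sum>k. \<bar>x k\<bar>" .

definition dist_l1 :: "l1 \<Rightarrow> l1 \<Rightarrow> real"
  where "dist_l1 x y = norm (x - y)"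

definition sgn_l1 :: "l1 \<Rightarrow> l1"
  where "sgn_l1 x = x /\<^sub>R norm x"

definition uniformity_l1 :: "(l1 \<times> l1) filter"
  where "uniformity_l1 = (INF e\<in>{0 <..}. principal {(x, y). dist x y < e})"

definition open_l1 :: "l1 set \<Rightarrow> bool"
  where "open_l1 S = (\<forall>x\<in>S. \<forall>\<^sub>F (x', y) in uniformity. x' = x \<longrightarrow> y \<in> S)"

instance
proof
  fix x y :: l1 and a :: real
  show "norm x = 0 \<longleftrightarrow> x = 0"
    by transfer (auto simp: suminf_eq_zero_iff fun_eq_iff)
  show "norm (x + y) \<le> norm x + norm y"
  proof -
    have "norm (x + y) = (\<Sum>k. \<bar>l1_nth x k + l1_nth y k\<bar>)"
      by (simp add: norm_l1.rep_eq plus_l1.rep_eq)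
    also have "\<dots> \<le> (\<Sum>k. \<bar>l1_nth x k\<bar> + \<bar>l1_nth y k\<bar>)"
    proof (rule suminf_le)
      show "summable (\<lambda>k. \<bar>l1_nth x k + l1_nth y k\<bar>)"
        using summable_abs_l1[of "x + y"] by (simp add: plus_l1.rep_eq)
    qed (auto intro: summable_add)
    also have "\<dots> = norm x + norm y"
      unfolding norm_l1.rep_eq by (simp add: suminf_add)
    finally show ?thesis .
  qed
  show "norm (a *\<^sub>R x) = \<bar>a\<bar> * norm x"
    by transfer (simp add: abs_mult suminf_mult)
qed (rule dist_l1_def sgn_l1_def open_l1_def uniformity_l1_def)+

end

declare [[coercion l1_nth]]

lemma l1_nth_simps [simp]:
  "l1_nth 0 k = 0" "l1_nth (x + y) k = l1_nth x k + l1_nth y k"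
  "l1_nth (x - y) k = l1_nth x k - l1_nth y k" "l1_nth (- x) k = - l1_nth x k"
  "l1_nth (c *\<^sub>R x) k = c * l1_nth x k"
  by (transfer, simp)+

lemma l1_nth_sum [simp]: "l1_nth (\<Sum>i\<in>I. f i) k = (\<Sum>i\<in>I. l1_nth (f i) k)"
  by (induction I rule: infinite_finite_induct) auto

lift_definition l1_unit :: "nat \<Rightarrow> l1" is "\<lambda>j k. if k = j then 1 else 0"
  by (rule summable_finite[of "{_}"]) auto

lemma norm_l1_unit [simp]: "norm (l1_unit j) = 1"
  using suminf_finite[of "{j}" "\<lambda>k. \<bar>l1_nth (l1_unit j) k\<bar>"]
  by (simp add: norm_l1.rep_eq l1_unit.rep_eq)

lemma l1_unit_expansion: "(\<lambda>n. \<Sum>k<n. l1_nth x k *\<^sub>R l1_unit k) \<longlonglongrightarrow> x"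
proof -
  have nth: "l1_nth (x - (\<Sum>k<n. l1_nth x k *\<^sub>R l1_unit k)) j = (if j < n then 0 else l1_nth x j)"
    for n j
    by (simp add: l1_unit.rep_eq if_distrib[of "(*) _"] cong: if_cong)
  have "norm (x - (\<Sum>k<n. l1_nth x k *\<^sub>R l1_unit k)) = (\<Sum>j. \<bar>l1_nth x (j + n)\<bar>)" for n
  proof -
    let ?r = "x - (\<Sum>k<n. l1_nth x k *\<^sub>R l1_unit k)"
    have "norm ?r = (\<Sum>j. \<bar>l1_nth ?r (j + n)\<bar>) + (\<Sum>j<n. \<bar>l1_nth ?r j\<bar>)"
      unfolding norm_l1.rep_eq by (rule suminf_split_initial_segment[OF summable_abs_l1])
    then show ?thesis
      unfolding nth by simp
  qed
  moreover have "(\<lambda>n. \<Sum>j. \<bar>l1_nth x (j + n)\<bar>) \<longlonglongrightarrow> 0"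
    by (rule suminf_exist_split2) simp
  ultimately have "(\<lambda>n. norm ((\<Sum>k<n. l1_nth x k *\<^sub>R l1_unit k) - x)) \<longlonglongrightarrow> 0"
    by (simp only: norm_minus_commute)
  then show ?thesis
    by (simp only: tendsto_norm_zero_iff LIM_zero_iff)
qed

section \<open>The space of bounded sequences and its identification with the dual\<close>

text \<open>
  The topology of \<^typ>\<open>nat\<close> is discrete, so the bounded continuous functions on it are all bounded
  sequences; their library norm is the supremum norm.
\<close>

type_synonym linf = "nat \<Rightarrow>\<^sub>C real"

lemma nat_bcontfun_iff: "f \<in> bcontfun \<longleftrightarrow> bounded (range f)" for f :: "nat \<Rightarrow> real"
  by (simp add: bcontfun_def)

lemma abs_linf_le: "\<bar>apply_bcontfun \<xi> k\<bar> \<le> norm \<xi>" for \<xi> :: linf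
  using norm_bounded[of \<xi> k] by simp

lemma linf_l1_bound:
  fixes \<xi> :: linf and x :: l1
  shows "summable (\<lambda>k. \<xi> k * x k)" and "\<bar>\<Sum>k. \<xi> k * x k\<bar> \<le> norm \<xi> * norm x"
proof -
  have le: "\<bar>\<xi> k * x k\<bar> \<le> norm \<xi> * \<bar>x k\<bar>" for k
    by (simp add: abs_mult abs_linf_le mult_right_mono)
  have s: "summable (\<lambda>k. norm \<xi> * \<bar>x k\<bar>)"
    by (simp add: summable_mult)
  have a: "summable (\<lambda>k. \<bar>\<xi> k * x k\<bar>)"
    by (rule summable_comparison_test'[OF s, where N = 0]) (use le in auto)
  then show "summable (\<lambda>k. \<xi> k * x k)"
    by (rule summable_rabs_cancel)
  have "\<bar>\<Sum>k. \<xi> k * x k\<bar> \<le> (\<Sum>k. \<bar>\<xi> k * x k\<bar>)"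
    by (rule summable_rabs[OF a])
  also have "\<dots> \<le> (\<Sum>k. norm \<xi> * \<bar>x k\<bar>)"
    by (rule suminf_le[OF le a s])
  also have "\<dots> = norm \<xi> * norm x"
    by (simp add: norm_l1.rep_eq suminf_mult)
  finally show "\<bar>\<Sum>k. \<xi> k * x k\<bar> \<le> norm \<xi> * norm x" .
qed

lift_definition linf_to_dual :: "linf \<Rightarrow> (l1 \<Rightarrow>\<^sub>L real)"
  is "\<lambda>(\<xi> :: linf) (x :: l1). \<Sum>k. \<xi> k * x k"
proof (rule bounded_linear_intro)
  fix \<xi> :: linf and x y :: l1 and r :: real
  show "(\<Sum>k. \<xi> k * (x + y) k) = (\<Sum>k. \<xi> k * x k) + (\<Sum>k. \<xi> k * y k)"
    by (simp add: distrib_left suminf_add linf_l1_bound)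
  show "(\<Sum>k. \<xi> k * (r *\<^sub>R x) k) = r *\<^sub>R (\<Sum>k. \<xi> k * x k)"
    by (simp add: mult.left_commute suminf_mult linf_l1_bound)
  show "norm (\<Sum>k. \<xi> k * x k) \<le> norm x * norm \<xi>"
    using linf_l1_bound(2)[of \<xi> x] by (simp add: mult.commute)
qed

lemma linf_to_dual_unit: "linf_to_dual \<xi> (l1_unit k) = \<xi> k"
  using suminf_finite[of "{k}" "\<lambda>j. \<xi> j * l1_nth (l1_unit k) j"]
  by (simp add: linf_to_dual.rep_eq l1_unit.rep_eq)

lemma norm_linf_to_dual: "norm (linf_to_dual \<xi>) = norm \<xi>"
proof (rule antisym)
  show "norm (linf_to_dual \<xi>) \<le> norm \<xi>"
    by (rule norm_blinfun_bound) (auto simp: linf_to_dual.rep_eq linf_l1_bound)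
  show "norm \<xi> \<le> norm (linf_to_dual \<xi>)"
  proof (rule norm_bound)
    fix k show "norm (\<xi> k) \<le> norm (linf_to_dual \<xi>)"
      using norm_blinfun[of "linf_to_dual \<xi>" "l1_unit k"] by (simp add: linf_to_dual_unit)
  qed
qed

lemma bij_linf_to_dual: "bij linf_to_dual"
proof (rule bijI)
  show "inj linf_to_dual"
  proof (rule injI, rule bcontfun_eqI)
    fix \<xi> \<zeta> k
    assume "linf_to_dual \<xi> = linf_to_dual \<zeta>"
    then have "linf_to_dual \<xi> (l1_unit k) = linf_to_dual \<zeta> (l1_unit k)"
      by (rule arg_cong)
    then show "\<xi> k = \<zeta> k"
      by (simp only: linf_to_dual_unit)
  qed
  show "surj linf_to_dual"
  proof (rule surjI)
    fix \<phi> :: "l1 \<Rightarrow>\<^sub>L real"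
    have "norm (\<phi> (l1_unit k)) \<le> norm \<phi>" for k
      using norm_blinfun[of \<phi> "l1_unit k"] by simp
    then have "(\<lambda>k. \<phi> (l1_unit k)) \<in> bcontfun"
      unfolding nat_bcontfun_iff bounded_iff by blast
    then have nth: "apply_bcontfun (Bcontfun (\<lambda>k. \<phi> (l1_unit k))) k = \<phi> (l1_unit k)" for k
      by (simp add: Bcontfun_inverse)
    show "linf_to_dual (Bcontfun (\<lambda>k. \<phi> (l1_unit k))) = \<phi>" (is "linf_to_dual ?\<xi> = \<phi>")
    proof (rule blinfun_eqI)
      fix x :: l1
      have "(\<lambda>n. \<phi> (\<Sum>k<n. x k *\<^sub>R l1_unit k)) \<longlonglongrightarrow> \<phi> x"
        by (intro tendsto_intros l1_unit_expansion)
      then have "(\<lambda>k. ?\<xi> k * x k) sums \<phi> x"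
        by (simp add: sums_def nth blinfun.sum_right blinfun.scaleR_right mult.commute)
      then show "linf_to_dual ?\<xi> x = \<phi> x"
        by (simp add: linf_to_dual.rep_eq sums_unique[symmetric])
    qed
  qed
qed

text \<open>The inverse is well defined by \<open>bij_linf_to_dual\<close>.\<close>

definition l1_adjoint :: "(l1 \<Rightarrow>\<^sub>L 'y::real_normed_vector) \<Rightarrow> ('y \<Rightarrow>\<^sub>L real) \<Rightarrow> linf"
  where "l1_adjoint A \<eta> = inv linf_to_dual (\<eta> o\<^sub>L A)"

lemma l1_adjoint_pairing: "(\<Sum>k. l1_adjoint A \<eta> k * l1_nth x k) = \<eta> (A x)"
proof -
  have "linf_to_dual (l1_adjoint A \<eta>) = \<eta> o\<^sub>L A"
    unfolding l1_adjoint_def by (rule surj_f_inv_f[OF bij_is_surj[OF bij_linf_to_dual]])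
  then have "linf_to_dual (l1_adjoint A \<eta>) x = (\<eta> o\<^sub>L A) x"
    by (rule arg_cong)
  then show ?thesis
    by (simp only: linf_to_dual.rep_eq blinfun_apply_blinfun_compose)
qed

section \<open>Supports, projections and sign patterns\<close>

definition supp :: "(nat \<Rightarrow> real) \<Rightarrow> nat set"
  where "supp x = {k. x k \<noteq> 0}"

definition proj :: "nat set \<Rightarrow> linf \<Rightarrow> linf"
  where "proj M \<xi> = Bcontfun (\<lambda>k. if k \<in> M then \<xi> k else 0)"

lemma proj_nth [simp]: "apply_bcontfun (proj M \<xi>) k = (if k \<in> M then \<xi> k else 0)"
proof -
  have "\<forall>k. norm (if k \<in> M then \<xi> k else 0) \<le> norm \<xi>"
    by (simp add: abs_linf_le)
  then have "(\<lambda>k. if k \<in> M then \<xi> k else 0) \<in> bcontfun"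
    unfolding nat_bcontfun_iff bounded_iff by blast
  then show ?thesis
    by (simp add: proj_def Bcontfun_inverse)
qed

definition sign_patterns :: "nat set \<Rightarrow> linf set"
  where "sign_patterns M = {\<xi> :: linf. supp \<xi> \<subseteq> M \<and> (\<forall>k. \<xi> k \<in> {-1, 0, 1})}"

definition sets_of_size_le :: "nat \<Rightarrow> nat set set"
  where "sets_of_size_le n = {M. finite M \<and> card M \<le> n}"

end

theory Submission
  imports Defs
begin

text \<open>
  For (1) \<open>\<Longrightarrow>\<close> (2) test \<open>A x\<close> with the functional \<open>\<eta>\<close> that belongs to the sign pattern of \<open>x\<close>.
  For (2) \<open>\<Longrightarrow>\<close> (1) let \<open>V\<close> be the space of sequences supported in \<open>supp \<xi>\<close>. On \<open>A ` V\<close> the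
  functional \<open>A x \<mapsto> \<Sum>k. \<xi> k * x k\<close> is well defined by injectivity and bounded by
  \<open>\<gamma> n\<close> by (2), and any Hahn--Banach extension of it is the required \<open>\<eta>\<close>. The Hahn--Banach theorem
  is obtained from the fact that a pointwise minimal sublinear functional is linear.
\<close>

section \<open>Sublinear functionals and the Hahn--Banach theorem\<close>

definition sublinear :: "('a::real_vector \<Rightarrow> real) \<Rightarrow> bool"
  where "sublinear p \<longleftrightarrow> (\<forall>x y. p (x + y) \<le> p x + p y) \<and> (\<forall>c>0. \<forall>x. p (c *\<^sub>R x) = c * p x)"

text \<open>The reverse inequality for scaling comes from the assumed one, applied to
  \<open>inverse c\<close> and \<open>c *\<^sub>R x\<close>.\<close>

lemma sublinearI:
  assumes "\<And>x y. p (x + y) \<le> p x + p y" and "\<And>c x. c > 0 \<Longrightarrow> p (c *\<^sub>R x) \<le> c * p x"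
  shows "sublinear p"
proof -
  have "c * p x \<le> p (c *\<^sub>R x)" if "c > 0" for c x
    using assms(2)[of "inverse c" "c *\<^sub>R x"] that by (simp add: field_simps)
  then show ?thesis
    using assms by (auto simp: sublinear_def intro: antisym)
qed

lemma sublinear_add: "sublinear p \<Longrightarrow> p (x + y) \<le> p x + p y"
  by (simp add: sublinear_def)

lemma sublinear_scaleR: "sublinear p \<Longrightarrow> c > 0 \<Longrightarrow> p (c *\<^sub>R x) = c * p x"
  by (simp add: sublinear_def)

lemma sublinear_zero: "sublinear p \<Longrightarrow> p 0 = 0"
  using sublinear_scaleR[of p 2 0] by simp

lemma sublinear_minus_ge: "sublinear p \<Longrightarrow> - p (- x) \<le> p x"
  using sublinear_add[of p x "- x"] sublinear_zero[of p] by simp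

lemma sublinear_scaled_norm: "c \<ge> 0 \<Longrightarrow> sublinear (\<lambda>x::'a::real_normed_vector. c * norm x)"
  by (rule sublinearI)
    (auto simp: distrib_left[symmetric] norm_triangle_ineq mult_left_mono)

text \<open>Oddness lets \<open>y\<close> be moved across: subadditivity at \<open>x + y\<close> and
  \<open>- y\<close> gives the missing half of additivity, and negative scalars reduce to positive
  ones.\<close>

lemma sublinear_odd_imp_linear:
  fixes q :: "'a::real_vector \<Rightarrow> real"
  assumes "sublinear q" and "\<And>x. q (- x) \<le> - q x"
  shows "linear q"
proof (rule linearI)
  have neg: "q (- x) = - q x" for x
    using assms(2)[of x] sublinear_minus_ge[OF assms(1), of x] by linarith
  fix x y :: 'a and c :: real
  show "q (x + y) = q x + q y"
    using sublinear_add[OF assms(1), of x y] sublinear_add[OF assms(1), of "x + y" "- y"] neg[of y]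
    by simp
  show "q (c *\<^sub>R x) = c *\<^sub>R q x"
  proof (cases c "0::real" rule: linorder_cases)
    case less
    then show ?thesis
      using sublinear_scaleR[OF assms(1), of "- c" x] neg[of "c *\<^sub>R x"] by simp
  qed (simp_all add: sublinear_zero[OF assms(1)] sublinear_scaleR[OF assms(1)])
qed

text \<open>
  The infimal convolution \<open>y \<mapsto> inf\<^bsub>u \<in> K\<^esub> (p (y + u) - r u)\<close>. For a subspace \<open>K\<close> it encodes the
  functional to be extended; for a ray \<open>K\<close> it shows that minimal sublinear functionals are odd.
\<close>

lemma sublinear_cone_reduction:
  fixes p r :: "'a::real_vector \<Rightarrow> real"
  assumes p: "sublinear p"
    and K0: "0 \<in> K" and r0: "r 0 = 0"
    and Kadd: "\<And>u v. u \<in> K \<Longrightarrow> v \<in> K \<Longrightarrow> u + v \<in> K"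
    and Kscale: "\<And>c u. c > 0 \<Longrightarrow> u \<in> K \<Longrightarrow> c *\<^sub>R u \<in> K"
    and radd: "\<And>u v. u \<in> K \<Longrightarrow> v \<in> K \<Longrightarrow> r u + r v \<le> r (u + v)"
    and rscale: "\<And>c u. c > 0 \<Longrightarrow> u \<in> K \<Longrightarrow> r (c *\<^sub>R u) = c * r u"
    and le: "\<And>u. u \<in> K \<Longrightarrow> r u \<le> p u"
  obtains q where "sublinear q" "\<And>x. q x \<le> p x" "\<And>u. u \<in> K \<Longrightarrow> q (- u) \<le> - r u"
proof -
  define q where "q y = (INF u\<in>K. p (y + u) - r u)" for y
  \<comment> \<open>A bound independent of \<open>u\<close>, so the infimum is finite:
    \<open>r u \<le> p u \<le> p (- y) + p (y + u)\<close>.\<close>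
  have "- p (- y) \<le> p (y + u) - r u" if "u \<in> K" for y u
    using le[OF that] sublinear_add[OF p, of "- y" "y + u"] by simp
  then have bdd: "bdd_below ((\<lambda>u. p (y + u) - r u) ` K)" for y
    by (meson bdd_belowI2)
  have q_le: "q y \<le> p (y + u) - r u" if "u \<in> K" for y u
    unfolding q_def by (rule cINF_lower[OF bdd that])
  have le_q: "b \<le> q y" if "\<And>u. u \<in> K \<Longrightarrow> b \<le> p (y + u) - r u" for b y
    unfolding q_def by (rule cINF_greatest) (use K0 that in auto)
  show thesis
  proof (rule that)
    show "sublinear q"
    proof (rule sublinearI)
      fix x y
      \<comment> \<open>The two infima are taken one after the other: first over \<open>v\<close>
        with \<open>u\<close> fixed, then over \<open>u\<close>. The competitor for
        \<open>x + y\<close> is \<open>u + v\<close>.\<close>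
      have "q (x + y) - (p (x + u) - r u) \<le> q y" if u: "u \<in> K" for u
      proof (rule le_q)
        fix v assume v: "v \<in> K"
        show "q (x + y) - (p (x + u) - r u) \<le> p (y + v) - r v"
          using q_le[OF Kadd[OF u v], of "x + y"] radd[OF u v]
            sublinear_add[OF p, of "x + u" "y + v"]
          by (simp add: algebra_simps)
      qed
      then have "q (x + y) - q y \<le> q x"
        by (intro le_q) (simp add: algebra_simps)
      then show "q (x + y) \<le> q x + q y"
        by simp
    next
      fix c :: real and x
      assume c: "c > 0"
      have "q (c *\<^sub>R x) / c \<le> q x"
      proof (rule le_q)
        fix u assume u: "u \<in> K"
        have "q (c *\<^sub>R x) \<le> c * p (x + u) - c * r u"
          using q_le[OF Kscale[OF c u], of "c *\<^sub>R x"]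
          by (simp add: sublinear_scaleR[OF p c, symmetric] rscale[OF c u] scaleR_add_right)
        then show "q (c *\<^sub>R x) / c \<le> p (x + u) - r u"
          using c by (simp add: field_simps)
      qed
      then show "q (c *\<^sub>R x) \<le> c * q x"
        using c by (simp add: field_simps)
    qed
    show "q x \<le> p x" for x
      using q_le[OF K0, of x] r0 by simp
    show "q (- u) \<le> - r u" if "u \<in> K" for u
      using q_le[OF that, of "- u"] sublinear_zero[OF p] by simp
  qed
qed

section \<open>Minimal sublinear functionals via Zorn's lemma\<close>

text \<open>The pointwise infimum works. It is finite because \<open>q \<le> p\<close> forces
  \<open>q x \<ge> - q (- x) \<ge> - p (- x)\<close>.\<close>

lemma sublinear_chain_Inf:
  fixes C :: "('a::real_vector \<Rightarrow> real) set"
  assumes ne: "C \<noteq> {}"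
    and C: "\<And>q. q \<in> C \<Longrightarrow> sublinear q \<and> q \<le> p"
    and chain: "\<And>q q'. q \<in> C \<Longrightarrow> q' \<in> C \<Longrightarrow> q \<le> q' \<or> q' \<le> q"
  obtains m where "sublinear m" "\<And>q. q \<in> C \<Longrightarrow> m \<le> q"
proof -
  define m where "m x = (INF q\<in>C. q x)" for x
  have "- p (- x) \<le> q x" if "q \<in> C" for q x
    using C[OF that] sublinear_minus_ge[of q x] by (auto simp: le_fun_def dest: spec[of _ "- x"])
  then have bdd: "bdd_below ((\<lambda>q. q x) ` C)" for x
    by (meson bdd_belowI2)
  have m_le: "m x \<le> q x" if "q \<in> C" for q x
    unfolding m_def by (rule cINF_lower[OF bdd that])
  have le_m: "b \<le> m x" if "\<And>q. q \<in> C \<Longrightarrow> b \<le> q x" for b x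
    unfolding m_def by (rule cINF_greatest[OF ne that])
  show thesis
  proof (rule that)
    show "sublinear m"
    proof (rule sublinearI)
      fix x y
      \<comment> \<open>Subadditivity mixes two members of \<open>C\<close>; the smaller of the two
        serves at both points.\<close>
      have *: "m (x + y) \<le> q x + q' y" if q: "q \<in> C" "q' \<in> C" for q q'
      proof -
        obtain s where s: "s \<in> C" "s \<le> q" "s \<le> q'"
          using chain[OF q] q by auto
        then have "m (x + y) \<le> s x + s y"
          using m_le[of s "x + y"] C[of s] sublinear_add[of s x y] by linarith
        also have "\<dots> \<le> q x + q' y"
          using s by (intro add_mono) (auto simp: le_fun_def)
        finally show ?thesis .
      qed
      have "m (x + y) - q x \<le> m y" if "q \<in> C" for q
        by (rule le_m) (use *[OF that] in \<open>simp add: algebra_simps\<close>)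
      then have "m (x + y) - m y \<le> m x"
        by (intro le_m) (simp add: algebra_simps)
      then show "m (x + y) \<le> m x + m y"
        by simp
    next
      fix c :: real and x
      assume c: "c > 0"
      have "m (c *\<^sub>R x) / c \<le> m x"
      proof (rule le_m)
        fix q assume "q \<in> C"
        then show "m (c *\<^sub>R x) / c \<le> q x"
          using m_le[of q "c *\<^sub>R x"] C[of q] c by (simp add: sublinear_scaleR field_simps)
      qed
      then show "m (c *\<^sub>R x) \<le> c * m x"
        using c by (simp add: field_simps)
    qed
    show "m \<le> q" if "q \<in> C" for q
      using m_le[OF that] by (simp add: le_fun_def)
  qed
qed

lemma exists_minimal_sublinear:
  fixes p :: "'a::real_vector \<Rightarrow> real"
  assumes "sublinear p"
  obtains m where "sublinear m" "m \<le> p" "\<And>q. sublinear q \<Longrightarrow> q \<le> m \<Longrightarrow> q = m"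
proof -
  define S where "S = {q. sublinear q \<and> q \<le> p}"
  have "\<exists>m\<in>S. \<forall>q\<in>S. q \<le> m \<longrightarrow> q = m"
  proof (rule predicate_Zorn)
    \<comment> \<open>The order is reversed, so the maximal element provided by Zorn's lemma is a
      minimal functional.\<close>
    show "partial_order_on S (relation_of (\<lambda>q q'. q' \<le> q) S)"
      by (rule partial_order_on_relation_ofI) auto
    fix C
    assume "C \<in> Chains (relation_of (\<lambda>q q'. q' \<le> q) S)"
    then have sub: "C \<subseteq> S" and chain: "\<And>q q'. q \<in> C \<Longrightarrow> q' \<in> C \<Longrightarrow> q \<le> q' \<or> q' \<le> q"
      by (auto simp: Chains_def relation_of_def)
    show "\<exists>u\<in>S. \<forall>q\<in>C. u \<le> q"
    proof (cases "C = {}")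
      \<comment> \<open>The empty chain is bounded by \<open>p\<close> itself.\<close>
      case True
      then show ?thesis
        using assms by (auto simp: S_def)
    next
      case False
      have "\<And>q. q \<in> C \<Longrightarrow> sublinear q \<and> q \<le> p"
        using sub by (auto simp: S_def)
      then obtain m where m: "sublinear m" "\<And>q. q \<in> C \<Longrightarrow> m \<le> q"
        using sublinear_chain_Inf[OF False _ chain, of p] by blast
      moreover have "m \<le> p"
        using False sub m(2) by (force simp: S_def intro: order_trans)
      ultimately show ?thesis
        by (auto simp: S_def)
    qed
  qed
  then show thesis
    by (auto simp: S_def intro: that order_trans)
qed

text \<open>Reducing a minimal \<open>m\<close> along the ray through \<open>x\<close> gives a
  sublinear \<open>q \<le> m\<close> with \<open>q (- x) \<le> - m x\<close>. Minimality forces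
  \<open>q = m\<close>, so \<open>m\<close> is odd and hence linear.\<close>

lemma exists_linear_le_sublinear:
  fixes p :: "'a::real_vector \<Rightarrow> real"
  assumes "sublinear p"
  obtains f where "linear f" "\<And>x. f x \<le> p x"
proof -
  obtain m where m: "sublinear m" "m \<le> p" and min: "\<And>q. sublinear q \<Longrightarrow> q \<le> m \<Longrightarrow> q = m"
    using exists_minimal_sublinear[OF assms] by blast
  have "m (- x) \<le> - m x" for x
  proof -
    \<comment> \<open>Only nonnegative multiples: there \<open>m\<close> is additive by homogeneity,
      while on the whole line additivity would already contain the oddness to be shown.\<close>
    let ?K = "(\<lambda>t. t *\<^sub>R x) ` {0..}"
    have ray: "m (t *\<^sub>R x) = t * m x" if "t \<ge> 0" for t
      using that sublinear_zero[OF m(1)] sublinear_scaleR[OF m(1)] by (cases "t = 0") auto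
    obtain q where q: "sublinear q" "\<And>y. q y \<le> m y" "\<And>u. u \<in> ?K \<Longrightarrow> q (- u) \<le> - m u"
    proof (rule sublinear_cone_reduction[OF m(1), of ?K m])
      show "0 \<in> ?K"
        by (rule image_eqI[of _ _ 0]) auto
      show "u + v \<in> ?K" if "u \<in> ?K" "v \<in> ?K" for u v
        using that by (auto simp: scaleR_add_left[symmetric])
      show "c *\<^sub>R u \<in> ?K" if "c > 0" "u \<in> ?K" for c u
        using that by auto
      show "m u + m v \<le> m (u + v)" if "u \<in> ?K" "v \<in> ?K" for u v
        using that by (auto simp: scaleR_add_left[symmetric] ray distrib_right simp del: scaleR_add_left)
    qed (auto simp: sublinear_zero[OF m(1)] sublinear_scaleR[OF m(1)])
    have "q = m"
      using q by (intro min) (auto simp: le_fun_def)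
    moreover have "x \<in> ?K"
      by (rule image_eqI[of _ _ 1]) auto
    ultimately show ?thesis
      using q(3) by blast
  qed
  then have "linear m"
    by (rule sublinear_odd_imp_linear[OF m(1)])
  then show thesis
    using that m(2) by (auto simp: le_fun_def)
qed

section \<open>Extension of functionals from a subspace\<close>

text \<open>After reduction over \<open>U\<close>, every linear \<open>f \<le> q\<close> satisfies
  \<open>- f u = f (- u) \<le> q (- u) \<le> - r u\<close> on \<open>U\<close>. Since
  \<open>U\<close> is symmetric, this inequality is an equality.\<close>

theorem Hahn_Banach_sublinear:
  fixes p r :: "'a::real_vector \<Rightarrow> real"
  assumes p: "sublinear p" and U: "subspace U"
    and radd: "\<And>u v. u \<in> U \<Longrightarrow> v \<in> U \<Longrightarrow> r (u + v) = r u + r v"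
    and rscale: "\<And>c u. u \<in> U \<Longrightarrow> r (c *\<^sub>R u) = c * r u"
    and le: "\<And>u. u \<in> U \<Longrightarrow> r u \<le> p u"
  obtains f where "linear f" "\<And>x. f x \<le> p x" "\<And>u. u \<in> U \<Longrightarrow> f u = r u"
proof -
  have U0: "0 \<in> U"
    using U by (rule subspace_0)
  obtain q where q: "sublinear q" "\<And>x. q x \<le> p x" "\<And>u. u \<in> U \<Longrightarrow> q (- u) \<le> - r u"
  proof (rule sublinear_cone_reduction[OF p U0, of r])
    show "r 0 = 0"
      using rscale[OF U0, of 0] by simp
  qed (auto simp: radd rscale le subspace_add[OF U] subspace_scale[OF U])
  obtain f where f: "linear f" "\<And>x. f x \<le> q x"
    using exists_linear_le_sublinear[OF q(1)] by blast
  have ge: "r u \<le> f u" if "u \<in> U" for u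
    using f(2)[of "- u"] q(3)[OF that] linear_neg[OF f(1), of u] by simp
  have "f u = r u" if u: "u \<in> U" for u
    using ge[OF u] ge[OF subspace_neg[OF U u]] rscale[OF u, of "-1"] linear_neg[OF f(1), of u]
    by simp
  then show thesis
    using that[of f] f q(2) order_trans by blast
qed

theorem Hahn_Banach_norm:
  fixes r :: "'a::real_normed_vector \<Rightarrow> real"
  assumes "c \<ge> 0" and "subspace U"
    and "\<And>u v. u \<in> U \<Longrightarrow> v \<in> U \<Longrightarrow> r (u + v) = r u + r v"
    and "\<And>a u. u \<in> U \<Longrightarrow> r (a *\<^sub>R u) = a * r u"
    and "\<And>u. u \<in> U \<Longrightarrow> r u \<le> c * norm u"
  obtains \<eta> :: "'a \<Rightarrow>\<^sub>L real" where "norm \<eta> \<le> c" "\<And>u. u \<in> U \<Longrightarrow> \<eta> u = r u"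
proof -
  obtain f where f: "linear f" "\<And>x. f x \<le> c * norm x" "\<And>u. u \<in> U \<Longrightarrow> f u = r u"
    using Hahn_Banach_sublinear[OF sublinear_scaled_norm[OF assms(1)] assms(2-5)] by blast
  \<comment> \<open>The one-sided bound at \<open>x\<close> and at \<open>- x\<close> together bound
    the absolute value.\<close>
  have bound: "norm (f x) \<le> c * norm x" for x
    using f(2)[of x] f(2)[of "- x"] linear_neg[OF f(1), of x] by simp
  have "bounded_linear f"
    using f(1) bound by (auto simp: bounded_linear_def bounded_linear_axioms_def mult.commute)
  then have app: "blinfun_apply (Blinfun f) = f"
    by (rule bounded_linear_Blinfun_apply)
  show thesis
  proof (rule that[of "Blinfun f"])
    show "norm (Blinfun f) \<le> c"
      by (rule norm_blinfun_bound) (use assms(1) bound app in auto)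
  qed (use f(3) app in auto)
qed

section \<open>Finitely supported sequences and sign patterns\<close>

lemma norm_l1_finite_supp:
  assumes "finite S" "supp (l1_nth x) \<subseteq> S"
  shows "norm x = (\<Sum>k\<in>S. \<bar>x k\<bar>)"
  unfolding norm_l1.rep_eq by (rule suminf_finite) (use assms in \<open>auto simp: supp_def\<close>)

lemma l1_adjoint_finite_supp:
  fixes A :: "l1 \<Rightarrow>\<^sub>L 'y::real_normed_vector" and \<eta> :: "'y \<Rightarrow>\<^sub>L real"
  assumes "finite S" "supp (l1_nth x) \<subseteq> S"
  shows "\<eta> (A x) = (\<Sum>k\<in>S. l1_adjoint A \<eta> k * x k)"
  unfolding l1_adjoint_pairing[symmetric]
  by (rule suminf_finite) (use assms in \<open>auto simp: supp_def\<close>)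

lemma l1_adjoint_nth:
  fixes A :: "l1 \<Rightarrow>\<^sub>L 'y::real_normed_vector" and \<eta> :: "'y \<Rightarrow>\<^sub>L real"
  shows "l1_adjoint A \<eta> k = \<eta> (A (l1_unit k))"
  using l1_adjoint_finite_supp[of "{k}" "l1_unit k" \<eta> A] by (simp add: supp_def l1_unit.rep_eq)

lemma sgn_sequence:
  obtains \<xi> :: linf where "\<And>k. \<xi> k = sgn (f k)"
proof -
  have "(\<lambda>k. sgn (f k)) \<in> bcontfun"
    unfolding nat_bcontfun_iff bounded_iff by (auto intro!: exI[of _ 1] simp: sgn_real_def)
  then show thesis
    using that[of "Bcontfun (\<lambda>k. sgn (f k))"] by (simp add: Bcontfun_inverse)
qed

section \<open>The two implications for a fixed finite support\<close>

text \<open>Pairing \<open>x\<close> with its own signs gives its norm, and the adjoint turns this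
  pairing into \<open>\<eta> (A x)\<close>.\<close>

lemma norm_le_of_sign_functional:
  fixes A :: "l1 \<Rightarrow>\<^sub>L 'y::real_normed_vector"
  assumes fin: "finite (supp (l1_nth x))"
    and \<eta>: "norm \<eta> \<le> c" "\<And>k. k \<in> supp (l1_nth x) \<Longrightarrow> l1_adjoint A \<eta> k = sgn (x k)"
  shows "norm x \<le> c * norm (A x)"
proof -
  have "norm x = (\<Sum>k\<in>supp (l1_nth x). \<bar>x k\<bar>)"
    by (rule norm_l1_finite_supp[OF fin order_refl])
  also have "\<dots> = (\<Sum>k\<in>supp (l1_nth x). l1_adjoint A \<eta> k * x k)"
    by (rule sum.cong) (auto simp: \<eta>(2) abs_sgn mult.commute)
  also have "\<dots> = \<eta> (A x)"
    by (rule l1_adjoint_finite_supp[OF fin order_refl, symmetric])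
  also have "\<dots> \<le> norm \<eta> * norm (A x)"
    using norm_blinfun[of \<eta> "A x"] by simp
  also have "\<dots> \<le> c * norm (A x)"
    by (rule mult_right_mono[OF \<eta>(1)]) simp
  finally show ?thesis .
qed

lemma exists_functional_of_pattern:
  fixes A :: "l1 \<Rightarrow>\<^sub>L 'y::real_normed_vector" and \<xi> :: "nat \<Rightarrow> real"
  assumes inj: "inj (blinfun_apply A)" and c: "c \<ge> 0" and S: "finite S"
    and \<xi>: "\<And>k. \<bar>\<xi> k\<bar> \<le> 1"
    and le: "\<And>x. supp (l1_nth x) \<subseteq> S \<Longrightarrow> norm x \<le> c * norm (A x)"
  obtains \<eta> :: "'y \<Rightarrow>\<^sub>L real" where "norm \<eta> \<le> c" "\<And>k. k \<in> S \<Longrightarrow> l1_adjoint A \<eta> k = \<xi> k"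
proof -
  define V where "V = {x :: l1. supp (l1_nth x) \<subseteq> S}"
  \<comment> \<open>Off the range of \<open>A\<close> the value of \<open>inv A\<close> is
    unspecified; \<open>r\<close> is evaluated only on the image of \<open>V\<close>.\<close>
  define r where "r y = (\<Sum>k\<in>S. \<xi> k * l1_nth (inv A y) k)" for y
  have r_A: "r (A x) = (\<Sum>k\<in>S. \<xi> k * x k)" for x
    by (simp add: r_def inv_f_f[OF inj])
  have "V = {x :: l1. \<forall>k. k \<notin> S \<longrightarrow> x k = 0}"
    by (auto simp: V_def supp_def)
  then have V: "subspace V"
    by (simp add: subspace_def)
  have sub: "subspace (blinfun_apply A ` V)"
    by (rule linear_subspace_image[OF bounded_linear.linear[OF blinfun.bounded_linear_right] V])
  obtain \<eta> :: "'y \<Rightarrow>\<^sub>L real"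
    where \<eta>: "norm \<eta> \<le> c" "\<And>u. u \<in> blinfun_apply A ` V \<Longrightarrow> \<eta> u = r u"
  proof (rule Hahn_Banach_norm[OF c sub, of r])
    show "r (u + v) = r u + r v" if "u \<in> blinfun_apply A ` V" "v \<in> blinfun_apply A ` V" for u v
      using that
      by (auto simp: blinfun.add_right[symmetric] r_A distrib_left sum.distrib)
    show "r (a *\<^sub>R u) = a * r u" if "u \<in> blinfun_apply A ` V" for a u
      using that
      by (auto simp: blinfun.scaleR_right[symmetric] r_A sum_distrib_left mult.left_commute)
    show "r u \<le> c * norm u" if u: "u \<in> blinfun_apply A ` V" for u
    proof -
      obtain x where x: "x \<in> V" "u = A x"
        using u by blast
      have "r u \<le> (\<Sum>k\<in>S. \<bar>x k\<bar>)"
        unfolding x(2) r_A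
      proof (rule sum_mono)
        fix k
        have "\<bar>\<xi> k\<bar> * \<bar>x k\<bar> \<le> 1 * \<bar>x k\<bar>"
          by (rule mult_right_mono[OF \<xi>]) simp
        then show "\<xi> k * x k \<le> \<bar>x k\<bar>"
          using abs_ge_self[of "\<xi> k * x k"] by (simp add: abs_mult)
      qed
      also have "\<dots> = norm x"
        using norm_l1_finite_supp[OF S] x(1) by (simp add: V_def)
      also have "\<dots> \<le> c * norm u"
        using le x by (simp add: V_def)
      finally show ?thesis .
    qed
  qed auto
  have "l1_adjoint A \<eta> k = \<xi> k" if k: "k \<in> S" for k
  proof -
    \<comment> \<open>Unit vectors at positions in \<open>S\<close> lie in \<open>V\<close>, so the
      extension property determines the adjoint coordinatewise on \<open>S\<close>.\<close>
    have "l1_unit k \<in> V"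
      using k by (auto simp: V_def supp_def l1_unit.rep_eq)
    then have "l1_adjoint A \<eta> k = r (A (l1_unit k))"
      by (simp add: l1_adjoint_nth \<eta>(2))
    also have "\<dots> = \<xi> k"
      using S k by (simp add: r_A l1_unit.rep_eq if_distrib[of "(*) _"] cong: if_cong)
    finally show ?thesis .
  qed
  with \<eta>(1) show thesis
    by (rule that)
qed

theorem proposition5p1:
  fixes A :: "l1 \<Rightarrow>\<^sub>L 'y::banach" and \<gamma> :: "nat \<Rightarrow> real"
  assumes "inj (blinfun_apply A)"
    and "\<forall>n\<ge>1. \<gamma> n > 0"
  shows "(\<forall>n\<ge>1. \<forall>\<xi>\<in>(\<Union>M\<in>sets_of_size_le n. sign_patterns M).
            \<exists>\<eta> :: 'y \<Rightarrow>\<^sub>L real. norm \<eta> \<le> \<gamma> n \<and> proj (supp (apply_bcontfun \<xi>)) (l1_adjoint A \<eta>) = \<xi>)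
     \<longleftrightarrow> (\<forall>n\<ge>1. \<forall>x :: l1. finite (supp (l1_nth x)) \<and> card (supp (l1_nth x)) \<le> n \<longrightarrow>
            norm (A x) \<ge> 1 / \<gamma> n * norm x)"
    (is "?functionals \<longleftrightarrow> ?bounds")
proof
  assume L: ?functionals
  show ?bounds
  proof (intro allI impI, elim conjE)
    fix n :: nat and x :: l1
    assume n: "n \<ge> 1" and x: "finite (supp (l1_nth x))" "card (supp (l1_nth x)) \<le> n"
    \<comment> \<open>The sign sequence of \<open>x\<close> has exactly the support of
      \<open>x\<close>, so the projection in (1) retains every coordinate that enters the
      norm.\<close>
    obtain \<xi> :: linf where \<xi>: "\<And>k. \<xi> k = sgn (x k)"
      using sgn_sequence by blast
    have supp: "supp \<xi> = supp (l1_nth x)"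
      by (simp add: supp_def \<xi> sgn_zero_iff)
    have "\<xi> \<in> sign_patterns (supp (l1_nth x))"
      by (auto simp: sign_patterns_def supp \<xi> sgn_real_def)
    then have "\<xi> \<in> (\<Union>M\<in>sets_of_size_le n. sign_patterns M)"
      using x by (auto simp: sets_of_size_le_def)
    then obtain \<eta> :: "'y \<Rightarrow>\<^sub>L real"
      where \<eta>: "norm \<eta> \<le> \<gamma> n" "proj (supp \<xi>) (l1_adjoint A \<eta>) = \<xi>"
      using L n by blast
    have "l1_adjoint A \<eta> k = sgn (x k)" if "k \<in> supp (l1_nth x)" for k
      using proj_nth[of "supp \<xi>" "l1_adjoint A \<eta>" k] that
      unfolding \<eta>(2) by (simp add: supp \<xi>)
    then have "norm x \<le> \<gamma> n * norm (A x)"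
      by (rule norm_le_of_sign_functional[OF x(1) \<eta>(1)])
    moreover have "\<gamma> n > 0"
      using assms(2) n by blast
    ultimately show "norm (A x) \<ge> 1 / \<gamma> n * norm x"
      by (simp add: field_simps)
  qed
next
  assume R: ?bounds
  show ?functionals
  proof (intro allI impI ballI)
    fix n :: nat and \<xi> :: linf
    assume n: "n \<ge> 1" and "\<xi> \<in> (\<Union>M\<in>sets_of_size_le n. sign_patterns M)"
    then obtain M where M: "finite M" "card M \<le> n" "supp \<xi> \<subseteq> M"
      and vals: "\<And>k. \<xi> k \<in> {-1, 0, 1}"
      by (auto simp: sets_of_size_le_def sign_patterns_def)
    have pos: "\<gamma> n > 0"
      using assms(2) n by blast
    \<comment> \<open>\<open>M\<close> may be larger than the support; from here on only
      \<open>supp \<xi>\<close> matters, and it inherits the size bound.\<close>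
    have fin: "finite (supp \<xi>)" and card: "card (supp \<xi>) \<le> n"
      using M by (auto intro: finite_subset order_trans[OF card_mono])
    obtain \<eta> :: "'y \<Rightarrow>\<^sub>L real"
      where \<eta>: "norm \<eta> \<le> \<gamma> n" "\<And>k. k \<in> supp \<xi> \<Longrightarrow> l1_adjoint A \<eta> k = \<xi> k"
    proof (rule exists_functional_of_pattern[OF assms(1) less_imp_le[OF pos] fin, of \<xi>])
      show "\<bar>\<xi> k\<bar> \<le> 1" for k
        using vals[of k] by auto
      fix x :: l1
      \<comment> \<open>Such an \<open>x\<close> has at most \<open>n\<close> nonzero entries, so
        (2) applies with the same constant \<open>\<gamma> n\<close> for all of them.\<close>
      assume "supp (l1_nth x) \<subseteq> supp \<xi>"
      then have "finite (supp (l1_nth x))" "card (supp (l1_nth x)) \<le> n"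
        using fin card by (auto intro: finite_subset order_trans[OF card_mono])
      then have "norm (A x) \<ge> 1 / \<gamma> n * norm x"
        using R n by blast
      then show "norm x \<le> \<gamma> n * norm (A x)"
        using pos by (simp add: field_simps)
    qed auto
    have "proj (supp \<xi>) (l1_adjoint A \<eta>) = \<xi>"
      \<comment> \<open>On the support the values agree by the choice of \<open>\<eta>\<close>; off
        it both sides vanish.\<close>
      by (rule bcontfun_eqI) (use \<eta>(2) in \<open>auto simp: supp_def\<close>)
    with \<eta>(1) show "\<exists>\<eta> :: 'y \<Rightarrow>\<^sub>L real. norm \<eta> \<le> \<gamma> n \<and> proj (supp \<xi>) (l1_adjoint A \<eta>) = \<xi>"
      by blast
  qed
qed

end
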